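(* Let $r > 0$ and let $\Omega \subseteq \mathbb{R}^n$ be open and connected. Then the following conditions are equivalent: (i) $\Omega$ is $r$-convex. (ii) $\Omega$ is convex, and for all $x \in \partial \Omega$, every unit normal $v$ to $\Omega$ at $x$ quadratically supports $\Omega$ with radius $r$ at $x$ locally. (iii) $\Omega$ is quadratically supported with radius $r$ at each of its boundary points locally.
   Context: $\mathbb{R}^n$ carries the Euclidean inner product $\langle\cdot|\cdot\rangle$ and norm $\|\cdot\|$; $\partial\Omega$ is the boundary of $\Omega$. For $r>0$, a set $\Omega \subseteq \mathbb{R}^n$ is $r$-convex if for all $x,y \in \Omega$ the intersection of all closed balls of radius $r$ (centered at any $c \in \mathbb{R}^n$) that contain both $x$ and $y$ is a subset of $\Omega$; this intersection is considered equal to $\mathbb{R}^n$ if no such ball exists. A vector $v$ is a unit normal to $\Omega$ at $x \in \partial\Omega$ if $\|v\|=1$ and $\langle v | y-x\rangle \leq 0$ for all $y \in \Omega$. For $r>0$, the vector $v \in \mathbb{R}^n$ quadratically supports $\Omega$ with radius $r$ at $x \in \partial\Omega$ locally if $\|v\|=1$ and there exists a neighborhood $U \subseteq \mathbb{R}^n$ of $x$ such that $\|h\|^2 \leq 2r\mu$ whenever $h \in \mathbb{R}^n$, $\langle h|v\rangle = 0$, $\mu \in \mathbb{R}$ and $x+h-\mu v \in U \cap \Omega$. $\Omega$ is quadratically supported with radius $r$ at $x \in \partial\Omega$ locally if this condition is satisfied for some $v$.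
   Formalization: The formal theorem assumes n ≥ 2, because for n = 1 the statement fails: with r = 1 and Ω = (0,10), conditions (ii) and (iii) hold but Ω is not r-convex. *)

theory Defs
  imports "HOL-Analysis.Analysis"
begin

text \<open>
  The intersection of all closed balls of radius \<open>r\<close> containing \<open>x\<close> and \<open>y\<close>. If there is no
  such ball, then the family is empty and the intersection is \<open>UNIV\<close>.
\<close>

definition ball_segment :: "real \<Rightarrow> real ^ 'n \<Rightarrow> real ^ 'n \<Rightarrow> (real ^ 'n) set" where
  "ball_segment r x y = \<Inter>{cball c r | c. x \<in> cball c r \<and> y \<in> cball c r}"

definition r_convex :: "real \<Rightarrow> (real ^ 'n) set \<Rightarrow> bool" where
  "r_convex r \<Omega> \<longleftrightarrow> (\<forall>x\<in>\<Omega>. \<forall>y\<in>\<Omega>. ball_segment r x y \<subseteq> \<Omega>)"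

text \<open>
  The following notions are meant for boundary points only: \<open>x \<in> frontier \<Omega>\<close> is not part of
  the definitions and has to be required where they are used.
\<close>

definition unit_normal :: "real ^ 'n \<Rightarrow> (real ^ 'n) set \<Rightarrow> real ^ 'n \<Rightarrow> bool" where
  "unit_normal v \<Omega> x \<longleftrightarrow> norm v = 1 \<and> (\<forall>y\<in>\<Omega>. inner v (y - x) \<le> 0)"

definition quadratically_supports_locally ::
    "real ^ 'n \<Rightarrow> real \<Rightarrow> (real ^ 'n) set \<Rightarrow> real ^ 'n \<Rightarrow> bool" where
  "quadratically_supports_locally v r \<Omega> x \<longleftrightarrow>
     norm v = 1 \<and>
     (\<exists>U. open U \<and> x \<in> U \<and>
        (\<forall>h \<mu>. inner h v = 0 \<longrightarrow> x + h - \<mu> *\<^sub>R v \<in> U \<inter> \<Omega> \<longrightarrow> (norm h)\<^sup>2 \<le> 2 * r * \<mu>))"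

definition quadratically_supported_locally ::
    "real \<Rightarrow> (real ^ 'n) set \<Rightarrow> real ^ 'n \<Rightarrow> bool" where
  "quadratically_supported_locally r \<Omega> x \<longleftrightarrow>
     (\<exists>v. quadratically_supports_locally v r \<Omega> x)"

end

theory Submission
  imports Defs
begin

text \<open>
  All three conditions amount to saying that \<open>\<Omega>\<close> rolls freely inside a ball of radius \<open>r\<close>: for
  every boundary point \<open>x\<close> with outer unit normal \<open>v\<close>, \<open>\<Omega>\<close> lies in the ball
  \<open>cball (x - r *\<^sub>R v) r\<close>, whose boundary sphere touches the supporting hyperplane at \<open>x\<close>. In the
  coordinates of the quadratic support condition this reads \<open>(norm h)\<^sup>2 + \<mu>\<^sup>2 \<le> 2 * r * \<mu>\<close>, so it
  is only slightly stronger than quadratic support.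

  From \<open>r\<close>-convexity to the tangent ball: points \<open>x + t *\<^sub>R h\<close> of the supporting hyperplane are
  outside \<open>\<Omega>\<close>, so each of them is cut off by a ball of radius \<open>r\<close> from a given \<open>y \<in> \<Omega>\<close> and from
  points of \<open>\<Omega>\<close> near \<open>x\<close>. Taking \<open>h\<close> to be the tangential part of \<open>y - x\<close> and \<open>t \<rightarrow> 0\<close>, this
  forces \<open>y\<close> into the tangent ball (\<open>r_convex_unit_normal_imp_tangent_ball\<close>). Conversely, if
  \<open>p \<notin> \<Omega>\<close>, the segment from a point of \<open>\<Omega>\<close> to \<open>p\<close> meets the boundary, and the tangent ball
  there, moved inwards a little, separates \<open>p\<close> from any two given points of \<open>\<Omega>\<close>
  (\<open>tangent_balls_imp_r_convex\<close>).

  The main work is to pass from local quadratic support to the global tangent ball. Local support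
  is incompatible with a curve that passes through the boundary point inside \<open>closure \<Omega>\<close> and is
  less curved than the supporting paraboloid. Applied to segments, this shows that the set of points
  visible from a fixed point of \<open>\<Omega>\<close> is closed in \<open>\<Omega>\<close>; it is also open, so \<open>\<Omega>\<close> is convex by
  connectedness (\<open>quadratically_supported_imp_convex\<close>). Applied to circular arcs of radius greater
  than \<open>r\<close>, it shows that a segment in \<open>\<Omega>\<close> can be bent, with fixed end points, into an arc of any
  radius \<open>R > r\<close> without leaving \<open>\<Omega>\<close>: the first arc to touch the boundary would contradict the
  local support (\<open>arc_subset\<close>). If some \<open>y \<in> \<Omega>\<close> lay outside the tangent ball of radius \<open>R\<close> at \<open>x\<close>,
  the arc of radius \<open>R\<close> from \<open>x\<close> to \<open>y\<close>, bent towards \<open>v\<close>, would rise above the supporting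
  hyperplane at \<open>x\<close>, although it lies in \<open>closure \<Omega>\<close>. Finally \<open>R\<close> tends to \<open>r\<close>.

  Arcs shorter than a half circle only reach points at distance less than \<open>2 * R\<close> from \<open>x\<close>.
  Farther points are brought into this range along a segment to \<open>x\<close>, which works unless \<open>y\<close> lies
  exactly in direction \<open>- v\<close>. In dimension at least two \<open>y\<close> can be moved off this line; in dimension
  one a long interval satisfies the local condition and is not \<open>r\<close>-convex.
\<close>

section \<open>Tangent balls\<close>

lemma le_of_le_add_small_multiple:
  fixes a b c :: real
  assumes "\<And>t. 0 < t \<Longrightarrow> t < 1 \<Longrightarrow> a \<le> b + t * c"
  shows "a \<le> b"
proof -
  have "((\<lambda>t. b + t * c) \<longlongrightarrow> b + 0 * c) (at_right 0)"
    by (intro tendsto_intros)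
  moreover have "eventually (\<lambda>t. a \<le> b + t * c) (at_right 0)"
    unfolding eventually_at_right_field using assms by (intro exI[of _ 1]) auto
  ultimately show ?thesis
    using tendsto_lowerbound[of "\<lambda>t. b + t * c" "b + 0 * c" "at_right 0" a] by auto
qed

lemma norm_diff_sq_orthogonal:
  fixes d v :: "'a::real_inner"
  assumes "norm v = 1"
  shows "(norm (d - (d \<bullet> v) *\<^sub>R v))\<^sup>2 = (norm d)\<^sup>2 - (d \<bullet> v)\<^sup>2"
  using assms unfolding power2_norm_eq_inner
  by (simp add: inner_diff_left inner_diff_right inner_commute norm_eq_1 power2_eq_square)

text \<open>
  With \<open>y - x = h - \<mu> *\<^sub>R v\<close> the right-hand side is \<open>(norm h)\<^sup>2 + \<mu>\<^sup>2 \<le> 2 * r * \<mu>\<close>, the quadratic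
  support inequality strengthened by \<open>\<mu>\<^sup>2\<close>. It is affine in \<open>r\<close>, which makes limits in the radius easy.
\<close>

lemma mem_cball_tangent_iff:
  fixes x y v :: "'a::real_inner"
  assumes "norm v = 1" and "r \<ge> 0"
  shows "y \<in> cball (x - r *\<^sub>R v) r \<longleftrightarrow> (norm (y - x))\<^sup>2 \<le> 2 * r * (v \<bullet> (x - y))"
proof -
  have "y \<in> cball (x - r *\<^sub>R v) r \<longleftrightarrow> norm ((y - x) + r *\<^sub>R v) \<le> r"
    by (simp add: dist_norm norm_minus_commute algebra_simps)
  also have "\<dots> \<longleftrightarrow> (norm ((y - x) + r *\<^sub>R v))\<^sup>2 \<le> r\<^sup>2"
    using assms(2) by (meson norm_ge_zero power2_le_imp_le power_mono)
  also have "(norm ((y - x) + r *\<^sub>R v))\<^sup>2 = (norm (y - x))\<^sup>2 + 2 * r * (v \<bullet> (y - x)) + r\<^sup>2"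
    unfolding power2_norm_eq_inner using assms(1)
    by (simp add: inner_add_left inner_add_right inner_commute norm_eq_1 power2_eq_square)
  finally show ?thesis
    by (simp add: inner_diff_right algebra_simps)
qed

lemma frontier_notin_open: "open S \<Longrightarrow> x \<in> frontier S \<Longrightarrow> x \<notin> S"
  by (simp add: frontier_def interior_open)

lemma r_convex_imp_convex:
  assumes "r_convex r \<Omega>"
  shows "convex \<Omega>"
  unfolding convex_contains_segment
proof (intro ballI)
  fix a b assume "a \<in> \<Omega>" "b \<in> \<Omega>"
  moreover have "closed_segment a b \<subseteq> ball_segment r a b"
    unfolding ball_segment_def using closed_segment_subset[OF _ _ convex_cball] by blast
  ultimately show "closed_segment a b \<subseteq> \<Omega>"
    using assms unfolding r_convex_def by blast
qed

section \<open>Equivalence of r-convexity with the existence of tangent balls\<close>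

text \<open>
  Let \<open>y - x = h - \<mu> *\<^sub>R v\<close> with \<open>h\<close> orthogonal to \<open>v\<close>, and consider a ball of radius \<open>r\<close> with centre
  \<open>x - m\<close> that almost contains \<open>x\<close> but does not contain \<open>x + t *\<^sub>R h\<close>, for a small \<open>t\<close>. Then \<open>norm m\<close>
  is close to \<open>r\<close> and \<open>h \<bullet> m \<ge> 0\<close>, up to small errors. If the ball also contains \<open>y\<close>, this gives
  \<open>(norm (y - x))\<^sup>2 \<le> 2 * \<mu> * (v \<bullet> m) - 2 * (h \<bullet> m)\<close> up to small errors, which is at most
  \<open>2 * \<mu> * r\<close> in the limit.
\<close>

lemma r_convex_unit_normal_imp_tangent_ball:
  fixes \<Omega> :: "(real ^ 'n) set"
  assumes rc: "r_convex r \<Omega>" and r: "r > 0" and op: "open \<Omega>" and x: "x \<in> frontier \<Omega>"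
    and v: "unit_normal v \<Omega> x" and y: "y \<in> \<Omega>"
  shows "(norm (y - x))\<^sup>2 \<le> 2 * r * (v \<bullet> (x - y))"
proof -
  define \<mu> where "\<mu> = v \<bullet> (x - y)"
  define h where "h = y - x + \<mu> *\<^sub>R v"
  have vv: "v \<bullet> v = 1" and nv: "norm v = 1"
    using v by (auto simp: unit_normal_def norm_eq_1)
  have below: "v \<bullet> (z - x) \<le> 0" if "z \<in> \<Omega>" for z
    using v that by (auto simp: unit_normal_def)
  have \<mu>0: "\<mu> \<ge> 0"
    using below[OF y] by (simp add: \<mu>_def inner_diff_right)
  have hv: "v \<bullet> h = 0"
    by (simp add: h_def \<mu>_def inner_diff_right inner_add_right vv)
  have yx: "y - x = h - \<mu> *\<^sub>R v"
    by (simp add: h_def)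
  have bound: "(norm (y - x))\<^sup>2 \<le> 2 * r * \<mu> + t * (2 * \<mu> + 2 * (h \<bullet> h) + 2 * r + 1)"
    if t: "0 < t" "t < 1" for t
  proof -
    define p where "p = x + t *\<^sub>R h"
    have "p \<notin> \<Omega>"
    proof
      assume "p \<in> \<Omega>"
      then obtain \<delta> where \<delta>: "\<delta> > 0" "cball p \<delta> \<subseteq> \<Omega>"
        using op open_contains_cball by blast
      have "p + \<delta> *\<^sub>R v \<in> \<Omega>"
        using \<delta> nv by (auto simp: subset_iff dist_norm)
      from below[OF this] show False
        using \<delta>(1) hv vv by (simp add: p_def inner_add_right inner_diff_right)
    qed
    have "x \<in> closure \<Omega>"
      using x by (simp add: frontier_def)
    \<comment> \<open>The distance must be of smaller order than \<open>t\<close>: the error it causes in the bound below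
      for \<open>h \<bullet> m\<close> is divided by \<open>t\<close>.\<close>
    then obtain z where z: "z \<in> \<Omega>" "dist z x < t\<^sup>2"
      using t(1) unfolding closure_approachable by (meson zero_less_power)
    have "p \<notin> ball_segment r z y"
      using rc z(1) y \<open>p \<notin> \<Omega>\<close> unfolding r_convex_def by blast
    then obtain c where c: "dist c z \<le> r" "dist c y \<le> r" "dist c p > r"
      unfolding ball_segment_def by auto
    define m where "m = x - c"
    have m: "norm m \<le> r + t\<^sup>2"
      using z(2) c(1) dist_triangle[of x c z] by (simp add: m_def dist_norm norm_minus_commute)
    have mm: "m \<bullet> m \<le> (r + t\<^sup>2)\<^sup>2"
      using m by (metis norm_ge_zero power2_norm_eq_inner power_mono)
    have "norm (h - \<mu> *\<^sub>R v + m) \<le> r"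
      using c(2) by (simp add: m_def h_def dist_norm norm_minus_commute)
    then have "(norm (h - \<mu> *\<^sub>R v + m))\<^sup>2 \<le> r\<^sup>2"
      by (simp add: power_mono)
    moreover have "(norm (h - \<mu> *\<^sub>R v + m))\<^sup>2
        = (norm (y - x))\<^sup>2 + 2 * (h \<bullet> m) - 2 * \<mu> * (v \<bullet> m) + m \<bullet> m"
      unfolding yx power2_norm_eq_inner
      by (simp add: inner_add_left inner_add_right inner_diff_left inner_diff_right inner_commute
          algebra_simps)
    ultimately have 1: "(norm (y - x))\<^sup>2 + 2 * (h \<bullet> m) - 2 * \<mu> * (v \<bullet> m) + m \<bullet> m \<le> r\<^sup>2"
      by simp
    have "norm (m + t *\<^sub>R h) > r"
      using c(3) by (simp add: m_def p_def dist_norm norm_minus_commute algebra_simps)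
    then have "(norm (m + t *\<^sub>R h))\<^sup>2 > r\<^sup>2"
      using r by (simp add: power_strict_mono)
    moreover have "(norm (m + t *\<^sub>R h))\<^sup>2 = m \<bullet> m + 2 * t * (h \<bullet> m) + t\<^sup>2 * (h \<bullet> h)"
      unfolding power2_norm_eq_inner
      by (simp add: inner_add_left inner_add_right inner_commute power2_eq_square algebra_simps)
    ultimately have 2: "m \<bullet> m + 2 * t * (h \<bullet> m) + t\<^sup>2 * (h \<bullet> h) > r\<^sup>2"
      by simp
    have "v \<bullet> m \<le> norm v * norm m"
      by (rule norm_cauchy_schwarz)
    then have 3: "v \<bullet> m \<le> r + t\<^sup>2"
      using m nv by simp
    have "t * (2 * (h \<bullet> m) + t * (h \<bullet> h) + (2 * r + t\<^sup>2) * t) > 0"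
      using 2 mm by (simp add: power2_eq_square algebra_simps)
    then have 4: "2 * (h \<bullet> m) + t * (h \<bullet> h) + (2 * r + t\<^sup>2) * t > 0"
      using t(1) by (simp add: zero_less_mult_iff)
    have tt: "t\<^sup>2 \<le> t" "t\<^sup>2 \<le> 1"
      using t by (auto simp: power2_eq_square mult_le_one intro: mult_left_le)
    have "(norm (y - x))\<^sup>2
        \<le> 2 * \<mu> * (v \<bullet> m) - (1 - t) * (2 * (h \<bullet> m)) + t\<^sup>2 * (h \<bullet> h)"
      using 1 2 by (simp add: algebra_simps)
    also have "\<dots> \<le> 2 * \<mu> * (r + t\<^sup>2) + (1 - t) * (t * (h \<bullet> h) + (2 * r + t\<^sup>2) * t)
        + t\<^sup>2 * (h \<bullet> h)"
    proof -
      have "2 * \<mu> * (v \<bullet> m) \<le> 2 * \<mu> * (r + t\<^sup>2)"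
        using 3 \<mu>0 by (intro mult_left_mono) auto
      moreover have "(1 - t) * (- (2 * (h \<bullet> m))) \<le> (1 - t) * (t * (h \<bullet> h) + (2 * r + t\<^sup>2) * t)"
        using 4 t by (intro mult_left_mono) auto
      ultimately show ?thesis by simp
    qed
    also have "\<dots> \<le> 2 * \<mu> * (r + t) + 1 * (t * (h \<bullet> h) + (2 * r + 1) * t) + t * (h \<bullet> h)"
      using tt t r \<mu>0 by (intro add_mono mult_mono) auto
    finally show ?thesis
      by (simp add: algebra_simps)
  qed
  show ?thesis
    using le_of_le_add_small_multiple[OF bound] by (simp add: \<mu>_def)
qed

text \<open>
  The tangent ball at a boundary point \<open>x\<close> between \<open>a\<close> and \<open>p\<close> does not exclude \<open>p\<close> if \<open>p = x\<close>.
  But as \<open>\<Omega>\<close> is open, \<open>a\<close> and \<open>b\<close> are interior to the ball, so they stay in it when it is moved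
  slightly in direction \<open>- v\<close>, whereas \<open>x\<close> gets excluded.
\<close>

lemma tangent_balls_imp_r_convex:
  fixes \<Omega> :: "(real ^ 'n) set"
  assumes r: "r > 0" and op: "open \<Omega>"
    and balls: "\<And>x. x \<in> frontier \<Omega> \<Longrightarrow> \<exists>v. norm v = 1 \<and> \<Omega> \<subseteq> cball (x - r *\<^sub>R v) r"
  shows "r_convex r \<Omega>"
  unfolding r_convex_def
proof (intro ballI subsetI, rule ccontr)
  fix a b p assume ab: "a \<in> \<Omega>" "b \<in> \<Omega>" and p: "p \<in> ball_segment r a b" and "p \<notin> \<Omega>"
  then have "closed_segment a p \<inter> frontier \<Omega> \<noteq> {}"
    by (intro connected_Int_frontier) auto
  then obtain x where x: "x \<in> closed_segment a p" "x \<in> frontier \<Omega>"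
    by auto
  then obtain v where v: "norm v = 1" "\<Omega> \<subseteq> cball (x - r *\<^sub>R v) r"
    using balls by blast
  define c where "c = x - r *\<^sub>R v"
  have "\<Omega> \<subseteq> ball c r"
    using v(2) op interior_maximal[of \<Omega> "cball c r"] by (simp add: c_def)
  then have ca: "dist c a < r" and cb: "dist c b < r"
    using ab by auto
  define \<delta> where "\<delta> = min (r - dist c a) (r - dist c b)"
  have \<delta>: "\<delta> > 0" "dist c a + \<delta> \<le> r" "dist c b + \<delta> \<le> r"
    using ca cb by (auto simp: \<delta>_def)
  define c' where "c' = c - \<delta> *\<^sub>R v"
  have "dist c' c = \<delta>"
    using v(1) \<delta>(1) by (simp add: c'_def dist_norm)
  then have "a \<in> cball c' r" "b \<in> cball c' r"
    using \<delta> dist_triangle[of c' a c] dist_triangle[of c' b c] by auto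
  moreover from this have "p \<in> cball c' r"
    using p by (auto simp: ball_segment_def)
  ultimately have "x \<in> cball c' r"
    using x(1) closed_segment_subset[OF _ _ convex_cball] by blast
  moreover have "x - c' = (r + \<delta>) *\<^sub>R v"
    by (simp add: c'_def c_def algebra_simps)
  then have "dist c' x = r + \<delta>"
    using v(1) r \<delta>(1) by (simp add: dist_norm norm_minus_commute[of c'])
  ultimately have "r + \<delta> \<le> r"
    by simp
  then show False
    using \<delta>(1) by simp
qed

lemma tangent_ball_imp_quadratically_supports_locally:
  assumes "norm v = 1" and "\<And>y. y \<in> \<Omega> \<Longrightarrow> (norm (y - x))\<^sup>2 \<le> 2 * r * (v \<bullet> (x - y))"
  shows "quadratically_supports_locally v r \<Omega> x"
  unfolding quadratically_supports_locally_def
proof (intro conjI exI[of _ UNIV] allI impI)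
  fix h \<mu> assume hv: "h \<bullet> v = 0" and y: "x + h - \<mu> *\<^sub>R v \<in> UNIV \<inter> \<Omega>"
  have vv: "v \<bullet> v = 1" and vh: "v \<bullet> h = 0"
    using assms(1) hv by (auto simp: norm_eq_1 inner_commute)
  have "(norm (h - \<mu> *\<^sub>R v))\<^sup>2 \<le> 2 * r * (v \<bullet> (\<mu> *\<^sub>R v - h))"
    using assms(2)[of "x + h - \<mu> *\<^sub>R v"] y by (simp add: algebra_simps)
  moreover have "(norm (h - \<mu> *\<^sub>R v))\<^sup>2 = (norm h)\<^sup>2 + \<mu>\<^sup>2"
    unfolding power2_norm_eq_inner using hv vh vv
    by (simp add: inner_diff_left inner_diff_right power2_eq_square)
  ultimately have "(norm h)\<^sup>2 + \<mu>\<^sup>2 \<le> 2 * r * \<mu>"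
    using vv vh by (simp add: inner_diff_right)
  then show "(norm h)\<^sup>2 \<le> 2 * r * \<mu>"
    using zero_le_power2[of \<mu>] by linarith
qed (use assms(1) in auto)

section \<open>Local quadratic support\<close>

text \<open>
  The decomposition of \<open>z - x\<close> into \<open>h\<close> and \<open>\<mu>\<close> is made explicit here. Both inequalities are
  closed conditions, so they extend to \<open>closure \<Omega>\<close>; this is what makes them applicable to curves
  that touch the boundary.
\<close>

lemma quadratically_supports_locally_closure:
  fixes \<Omega> :: "(real ^ 'n) set"
  assumes qs: "quadratically_supports_locally v r \<Omega> x" and r: "r > 0"
  obtains \<epsilon> where "\<epsilon> > 0"
    "\<And>z. z \<in> closure \<Omega> \<Longrightarrow> dist z x < \<epsilon> \<Longrightarrow>
       (z - x) \<bullet> v \<le> 0 \<and> (norm (z - x))\<^sup>2 \<le> ((z - x) \<bullet> v)\<^sup>2 - 2 * r * ((z - x) \<bullet> v)"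
proof -
  from qs obtain U where nv: "norm v = 1" and U: "open U" "x \<in> U"
    and sup: "\<And>h \<mu>. h \<bullet> v = 0 \<Longrightarrow> x + h - \<mu> *\<^sub>R v \<in> U \<inter> \<Omega> \<Longrightarrow> (norm h)\<^sup>2 \<le> 2 * r * \<mu>"
    unfolding quadratically_supports_locally_def by blast
  define A where "A = {z. (z - x) \<bullet> v \<le> 0} \<inter>
    {z. (norm (z - x))\<^sup>2 \<le> ((z - x) \<bullet> v)\<^sup>2 - 2 * r * ((z - x) \<bullet> v)}"
  have clA: "closed A"
    unfolding A_def
    by (intro closed_Int closed_Collect_le continuous_intros)
  have "z \<in> A" if z: "z \<in> U \<inter> \<Omega>" for z
  proof -
    define h where "h = (z - x) - ((z - x) \<bullet> v) *\<^sub>R v"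
    have "h \<bullet> v = 0"
      using nv by (simp add: h_def inner_diff_left norm_eq_1)
    moreover have "x + h - (- ((z - x) \<bullet> v)) *\<^sub>R v \<in> U \<inter> \<Omega>"
      using z by (simp add: h_def)
    ultimately have *: "(norm h)\<^sup>2 \<le> 2 * r * (- ((z - x) \<bullet> v))"
      by (rule sup)
    moreover have "(norm h)\<^sup>2 = (norm (z - x))\<^sup>2 - ((z - x) \<bullet> v)\<^sup>2"
      unfolding h_def using nv by (rule norm_diff_sq_orthogonal)
    moreover have "0 \<le> 2 * r * (- ((z - x) \<bullet> v))"
      using * zero_le_power2[of "norm h"] by linarith
    then have "(z - x) \<bullet> v \<le> 0"
      using r by (simp add: mult_le_0_iff)
    ultimately show ?thesis
      by (simp add: A_def)
  qed
  then have "closure (U \<inter> \<Omega>) \<subseteq> A"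
    using clA by (intro closure_minimal) auto
  then have "U \<inter> closure \<Omega> \<subseteq> A"
    using open_Int_closure_subset[OF U(1), of \<Omega>] by blast
  moreover obtain \<epsilon> where "\<epsilon> > 0" "ball x \<epsilon> \<subseteq> U"
    using U open_contains_ball by blast
  ultimately show thesis
    using that[of \<epsilon>] by (auto simp: A_def subset_iff dist_commute)
qed

text \<open>
  A segment through \<open>x\<close> that stays, near \<open>x\<close>, on one side of the hyperplane through \<open>x\<close> orthogonal
  to \<open>v\<close> must lie in this hyperplane, where quadratic support leaves only the point \<open>x\<close> itself.
\<close>

lemma no_segment_through_support_point:
  fixes \<Omega> :: "(real ^ 'n) set"
  assumes qs: "quadratically_supports_locally v r \<Omega> x" and r: "r > 0"
    and ab: "closed_segment a b \<subseteq> closure \<Omega>"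
    and x: "x \<in> open_segment a b"
  shows False
proof -
  obtain \<epsilon> where \<epsilon>: "\<epsilon> > 0"
    and sup: "\<And>z. z \<in> closure \<Omega> \<Longrightarrow> dist z x < \<epsilon> \<Longrightarrow>
       (z - x) \<bullet> v \<le> 0 \<and> (norm (z - x))\<^sup>2 \<le> ((z - x) \<bullet> v)\<^sup>2 - 2 * r * ((z - x) \<bullet> v)"
    using quadratically_supports_locally_closure[OF qs r] by metis
  from x obtain t where t: "0 < t" "t < 1" "x = (1 - t) *\<^sub>R a + t *\<^sub>R b" and ne: "a \<noteq> b"
    by (auto simp: in_segment)
  define d where "d = b - a"
  have d: "norm d > 0"
    using ne by (simp add: d_def)
  define s where "s = min (min t (1 - t)) (\<epsilon> / (2 * norm d))"
  have s: "s > 0" "s \<le> t" "s \<le> 1 - t" "s * norm d < \<epsilon>"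
  proof -
    show "s > 0" "s \<le> t" "s \<le> 1 - t"
      using t \<epsilon> d by (auto simp: s_def)
    have "s * norm d \<le> \<epsilon> / (2 * norm d) * norm d"
      using d by (intro mult_right_mono) (auto simp: s_def)
    then show "s * norm d < \<epsilon>"
      using d \<epsilon> by simp
  qed
  have mem: "x + u *\<^sub>R d \<in> closure \<Omega>" if "\<bar>u\<bar> \<le> s" for u
  proof -
    have "x + u *\<^sub>R d = (1 - (t + u)) *\<^sub>R a + (t + u) *\<^sub>R b"
      by (simp add: t(3) d_def algebra_simps)
    moreover have "0 \<le> t + u" "t + u \<le> 1"
      using that s by auto
    ultimately have "x + u *\<^sub>R d \<in> closed_segment a b"
      unfolding in_segment by blast
    then show ?thesis using ab by blast
  qed
  have "d \<bullet> v \<le> 0"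
    using sup[OF mem[of s]] s d by (simp add: dist_norm mult_le_0_iff)
  moreover have "d \<bullet> v \<ge> 0"
    using sup[OF mem[of "- s"]] s d by (simp add: dist_norm mult_le_0_iff zero_le_mult_iff)
  ultimately have "(norm (s *\<^sub>R d))\<^sup>2 \<le> 0"
    using sup[OF mem[of s]] s d by (simp add: dist_norm)
  then show False
    using s d by simp
qed

text \<open>
  The local support inequality reaches a far point \<open>y\<close> because \<open>z - x\<close> can be scaled down in a
  convex set.
\<close>

lemma supports_locally_imp_unit_normal:
  fixes \<Omega> :: "(real ^ 'n) set"
  assumes qs: "quadratically_supports_locally v r \<Omega> x" and r: "r > 0"
    and conv: "convex \<Omega>" and x: "x \<in> closure \<Omega>"
  shows "unit_normal v \<Omega> x"
  unfolding unit_normal_def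
proof (intro conjI ballI)
  show "norm v = 1"
    using qs by (simp add: quadratically_supports_locally_def)
  fix y assume y: "y \<in> \<Omega>"
  obtain \<epsilon> where \<epsilon>: "\<epsilon> > 0"
    and sup: "\<And>z. z \<in> closure \<Omega> \<Longrightarrow> dist z x < \<epsilon> \<Longrightarrow> (z - x) \<bullet> v \<le> 0"
    using quadratically_supports_locally_closure[OF qs r] by metis
  define D where "D = norm (y - x) + 1"
  have D: "D > 0" "norm (y - x) \<le> D"
    using norm_ge_zero[of "y - x"] unfolding D_def by linarith+
  define t where "t = min 1 (\<epsilon> / (2 * D))"
  have t: "0 < t" "t \<le> 1"
    using \<epsilon> D by (auto simp: t_def)
  have "(1 - t) *\<^sub>R x + t *\<^sub>R y \<in> closure \<Omega>"
    using convex_closure[OF conv] x y t closure_subset[of \<Omega>] by (auto simp: convex_alt)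
  then have mem: "x + t *\<^sub>R (y - x) \<in> closure \<Omega>"
    by (simp add: algebra_simps)
  have "t * norm (y - x) \<le> \<epsilon> / (2 * D) * D"
    using t \<epsilon> D by (intro mult_mono) (auto simp: t_def)
  also have "\<dots> < \<epsilon>"
    using D(1) \<epsilon> by simp
  finally have "t * norm (y - x) < \<epsilon>" .
  then have "(t *\<^sub>R (y - x)) \<bullet> v \<le> 0"
    using sup[OF mem] t by (simp add: dist_norm)
  then show "v \<bullet> (y - x) \<le> 0"
    using t by (simp add: inner_commute mult_le_0_iff)
qed

section \<open>Convexity from local support\<close>

text \<open>
  The set \<open>S\<close> of points visible from \<open>a\<close> is open because segments are compact. A limit of segments
  inside \<open>\<Omega>\<close> is a segment inside \<open>closure \<Omega>\<close>, and it cannot touch the boundary between its end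
  points by \<open>no_segment_through_support_point\<close>; so \<open>S\<close> is closed in \<open>\<Omega>\<close>, and connectedness gives \<open>S = \<Omega>\<close>.
\<close>

lemma quadratically_supported_imp_convex:
  fixes \<Omega> :: "(real ^ 'n) set"
  assumes r: "r > 0" and op: "open \<Omega>" and con: "connected \<Omega>"
    and qs: "\<And>x. x \<in> frontier \<Omega> \<Longrightarrow> quadratically_supported_locally r \<Omega> x"
  shows "convex \<Omega>"
  unfolding convex_contains_segment
proof (intro ballI)
  fix a b assume a: "a \<in> \<Omega>" and b: "b \<in> \<Omega>"
  define S where "S = {y. closed_segment a y \<subseteq> \<Omega>}"
  have S_sub: "S \<subseteq> \<Omega>"
    by (auto simp: S_def)
  have "open S"
    unfolding open_dist
  proof (intro ballI)
    fix y assume "y \<in> S"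
    then have "closed_segment a y \<subseteq> \<Omega>"
      by (simp add: S_def)
    then obtain \<epsilon> where \<epsilon>: "\<epsilon> > 0" "(\<Union>z\<in>closed_segment a y. ball z \<epsilon>) \<subseteq> \<Omega>"
      using compact_subset_open_imp_ball_epsilon_subset[OF compact_segment op] by metis
    have "closed_segment a y' \<subseteq> \<Omega>" if "dist y' y < \<epsilon>" for y'
    proof
      fix z' assume "z' \<in> closed_segment a y'"
      then obtain t where t: "0 \<le> t" "t \<le> 1" "z' = (1 - t) *\<^sub>R a + t *\<^sub>R y'"
        by (auto simp: in_segment)
      define z where "z = (1 - t) *\<^sub>R a + t *\<^sub>R y"
      have "z - z' = t *\<^sub>R (y - y')"
        by (simp add: z_def t(3) algebra_simps)
      then have "dist z z' = t * dist y y'"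
        using t(1) by (simp add: dist_norm)
      also have "\<dots> \<le> dist y y'"
        using t by (simp add: mult_left_le_one_le)
      finally have "z' \<in> ball z \<epsilon>"
        using that by (simp add: dist_commute)
      moreover have "z \<in> closed_segment a y"
        using t by (auto simp: in_segment z_def)
      ultimately show "z' \<in> \<Omega>"
        using \<epsilon>(2) by blast
    qed
    then show "\<exists>\<epsilon>>0. \<forall>y'. dist y' y < \<epsilon> \<longrightarrow> y' \<in> S"
      using \<epsilon>(1) by (auto simp: S_def)
  qed
  moreover have "\<Omega> \<inter> closure S \<subseteq> S"
  proof
    fix y assume y: "y \<in> \<Omega> \<inter> closure S"
    then obtain f where f: "\<And>k. f k \<in> S" "f \<longlonglongrightarrow> y"
      by (auto simp: closure_sequential)
    have cl: "closed_segment a y \<subseteq> closure \<Omega>"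
    proof
      fix z assume "z \<in> closed_segment a y"
      then obtain t where t: "0 \<le> t" "t \<le> 1" "z = (1 - t) *\<^sub>R a + t *\<^sub>R y"
        by (auto simp: in_segment)
      have "(\<lambda>k. (1 - t) *\<^sub>R a + t *\<^sub>R f k) \<longlonglongrightarrow> z"
        unfolding t(3) by (intro tendsto_intros f(2))
      moreover have "(1 - t) *\<^sub>R a + t *\<^sub>R f k \<in> \<Omega>" for k
      proof -
        have "(1 - t) *\<^sub>R a + t *\<^sub>R f k \<in> closed_segment a (f k)"
          using t(1,2) unfolding in_segment by (intro exI[of _ t]) simp
        then show ?thesis
          using f(1)[of k] by (auto simp: S_def)
      qed
      ultimately show "z \<in> closure \<Omega>"
        unfolding closure_sequential by (intro exI[of _ "\<lambda>k. (1 - t) *\<^sub>R a + t *\<^sub>R f k"]) simp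
    qed
    have "closed_segment a y \<subseteq> \<Omega>"
    proof (rule ccontr)
      assume "\<not> closed_segment a y \<subseteq> \<Omega>"
      then obtain x where x: "x \<in> closed_segment a y" "x \<notin> \<Omega>"
        by auto
      then have "x \<in> frontier \<Omega>"
        using cl op by (auto simp: frontier_def interior_open)
      then obtain v where "quadratically_supports_locally v r \<Omega> x"
        using qs unfolding quadratically_supported_locally_def by blast
      moreover have "x \<in> open_segment a y"
        using x a y by (auto simp: open_segment_def)
      ultimately show False
        using no_segment_through_support_point r cl by blast
    qed
    then show "y \<in> S" by (simp add: S_def)
  qed
  ultimately have "S \<inter> \<Omega> = {} \<or> (- closure S) \<inter> \<Omega> = {}"
  proof (intro connectedD[OF con])
    show "S \<inter> - closure S \<inter> \<Omega> = {}"
      using closure_subset[of S] by blast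
    show "\<Omega> \<subseteq> S \<union> - closure S"
      using \<open>\<Omega> \<inter> closure S \<subseteq> S\<close> by blast
  qed auto
  moreover have "a \<in> S"
    using a by (simp add: S_def)
  ultimately have "\<Omega> \<subseteq> closure S"
    using a by blast
  then have "b \<in> S"
    using \<open>\<Omega> \<inter> closure S \<subseteq> S\<close> b by blast
  then show "closed_segment a b \<subseteq> \<Omega>"
    by (simp add: S_def)
qed

section \<open>Bending segments into circular arcs\<close>

text \<open>
  Let the circle have centre \<open>c\<close> and radius \<open>\<rho>\<close>. As its arc near \<open>x\<close> stays below the supporting
  hyperplane, its tangent at \<open>x\<close> is orthogonal to \<open>v\<close>, so the projection of \<open>v\<close> to the plane of the
  circle is \<open>k *\<^sub>R (x - c)\<close> with \<open>k \<le> 1 / \<rho>\<close>. A point of the circle whose distance from \<open>x\<close> has square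
  \<open>D\<close> therefore lies only \<open>\<mu> = k * D / 2 \<le> D / (2 * \<rho>)\<close> below the hyperplane, while quadratic
  support demands \<open>D \<le> \<mu>\<^sup>2 + 2 * r * \<mu>\<close>, hence \<open>1 \<le> D / (4 * \<rho>\<^sup>2) + r / \<rho>\<close>. This fails for small
  \<open>D\<close> as \<open>r < \<rho>\<close>.
\<close>

lemma no_larger_circle_through_support_point:
  fixes \<Omega> :: "(real ^ 'n) set"
  assumes qs: "quadratically_supports_locally v r \<Omega> x" and r: "r > 0" "r < \<rho>"
    and ew: "norm e = 1" "norm w = 1" "e \<bullet> w = 0"
    and \<xi>0: "\<bar>\<xi>\<^sub>0\<bar> < \<rho>" and x: "x = c + \<xi>\<^sub>0 *\<^sub>R e + sqrt (\<rho>\<^sup>2 - \<xi>\<^sub>0\<^sup>2) *\<^sub>R w"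
    and \<delta>: "\<delta> > 0"
    and arc: "\<And>\<xi>. \<bar>\<xi> - \<xi>\<^sub>0\<bar> < \<delta> \<Longrightarrow> c + \<xi> *\<^sub>R e + sqrt (\<rho>\<^sup>2 - \<xi>\<^sup>2) *\<^sub>R w \<in> closure \<Omega>"
  shows False
proof -
  obtain \<epsilon> where \<epsilon>: "\<epsilon> > 0"
    and sup: "\<And>z. z \<in> closure \<Omega> \<Longrightarrow> dist z x < \<epsilon> \<Longrightarrow>
       (z - x) \<bullet> v \<le> 0 \<and> (norm (z - x))\<^sup>2 \<le> ((z - x) \<bullet> v)\<^sup>2 - 2 * r * ((z - x) \<bullet> v)"
    using quadratically_supports_locally_closure[OF qs r(1)] by metis
  have nv: "norm v = 1"
    using qs by (simp add: quadratically_supports_locally_def)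
  define q where "q \<xi> = sqrt (\<rho>\<^sup>2 - \<xi>\<^sup>2)" for \<xi>
  define z where "z \<xi> = c + \<xi> *\<^sub>R e + q \<xi> *\<^sub>R w" for \<xi>
  have zx: "z \<xi>\<^sub>0 = x"
    by (simp add: z_def q_def x)
  have sq: "\<xi>\<^sup>2 < \<rho>\<^sup>2" if "\<bar>\<xi>\<bar> < \<rho>" for \<xi>
    using that by (metis abs_ge_zero power2_abs power_strict_mono zero_less_numeral)
  have q2: "(q \<xi>)\<^sup>2 = \<rho>\<^sup>2 - \<xi>\<^sup>2" if "\<bar>\<xi>\<bar> < \<rho>" for \<xi>
    using sq[OF that] by (simp add: q_def)
  have q0: "q \<xi>\<^sub>0 > 0"
    using sq[OF \<xi>0] by (simp add: q_def)
  have cont_z: "isCont z \<xi>\<^sub>0"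
    unfolding z_def q_def by (intro continuous_intros)
  then obtain \<eta> where \<eta>: "\<eta> > 0" "\<And>\<xi>. \<bar>\<xi> - \<xi>\<^sub>0\<bar> < \<eta> \<Longrightarrow> dist (z \<xi>) x < \<epsilon>"
    using \<epsilon> unfolding continuous_at_eps_delta dist_real_def zx by blast
  define \<theta> where "\<theta> = min (min \<delta> \<eta>) (\<rho> - \<bar>\<xi>\<^sub>0\<bar>)"
  have \<theta>: "\<theta> > 0"
    using \<delta> \<eta>(1) \<xi>0 by (simp add: \<theta>_def)
  have near: "\<bar>\<xi>\<bar> < \<rho>" "z \<xi> \<in> closure \<Omega>" "dist (z \<xi>) x < \<epsilon>" if "\<bar>\<xi> - \<xi>\<^sub>0\<bar> < \<theta>" for \<xi>
    using that arc[of \<xi>] \<eta>(2)[of \<xi>] unfolding \<theta>_def z_def q_def by auto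
  define A where "A = e \<bullet> v"
  define B where "B = w \<bullet> v"
  have zv: "(z \<xi> - x) \<bullet> v = (\<xi> - \<xi>\<^sub>0) * A + (q \<xi> - q \<xi>\<^sub>0) * B" for \<xi>
    unfolding zx[symmetric]
    by (simp add: z_def A_def B_def inner_add_left inner_diff_left algebra_simps)
  \<comment> \<open>The height of the arc over the hyperplane has a local maximum at \<open>x\<close>.\<close>
  have "((\<lambda>\<xi>. (\<xi> - \<xi>\<^sub>0) * A + (q \<xi> - q \<xi>\<^sub>0) * B) has_real_derivative
      A - (\<xi>\<^sub>0 / q \<xi>\<^sub>0) * B) (at \<xi>\<^sub>0)"
    unfolding q_def using sq[OF \<xi>0]
    by (auto intro!: derivative_eq_intros simp: field_simps)
  moreover have "(\<xi> - \<xi>\<^sub>0) * A + (q \<xi> - q \<xi>\<^sub>0) * B \<le> 0" if "\<bar>\<xi>\<^sub>0 - \<xi>\<bar> < \<theta>" for \<xi>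
    using sup[OF near(2,3)[of \<xi>]] that unfolding zv by (simp add: abs_minus_commute)
  ultimately have "A - (\<xi>\<^sub>0 / q \<xi>\<^sub>0) * B = 0"
    by (intro DERIV_local_max[OF _ \<theta>]) auto
  then have AB: "A = (B / q \<xi>\<^sub>0) * \<xi>\<^sub>0" "B = (B / q \<xi>\<^sub>0) * q \<xi>\<^sub>0"
    using q0 by auto
  define k where "k = B / q \<xi>\<^sub>0"
  have AB2: "A\<^sup>2 + B\<^sup>2 \<le> 1"
  proof -
    have "(norm (v - A *\<^sub>R e - B *\<^sub>R w))\<^sup>2 = 1 - A\<^sup>2 - B\<^sup>2"
      unfolding power2_norm_eq_inner using ew nv
      by (simp add: inner_diff_left inner_diff_right A_def B_def norm_eq_1 inner_commute
          power2_eq_square algebra_simps)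
    then show ?thesis
      using zero_le_power2[of "norm (v - A *\<^sub>R e - B *\<^sub>R w)"] by linarith
  qed
  have "A\<^sup>2 + B\<^sup>2 = k\<^sup>2 * (\<xi>\<^sub>0\<^sup>2 + (q \<xi>\<^sub>0)\<^sup>2)"
    using AB unfolding k_def[symmetric] by (metis distrib_left power_mult_distrib)
  also have "\<dots> = (k * \<rho>)\<^sup>2"
    using q2[OF \<xi>0] by (simp add: power_mult_distrib)
  finally have "\<bar>k * \<rho>\<bar> \<le> 1"
    using AB2 by (simp add: abs_square_le_1)
  then have k: "k \<le> 1 / \<rho>"
    using r by (simp add: field_simps)
  have key: "1 - r / \<rho> \<le> (norm (z \<xi> - x))\<^sup>2 / (4 * \<rho>\<^sup>2)"
    if \<xi>: "\<bar>\<xi> - \<xi>\<^sub>0\<bar> < \<theta>" "\<xi> \<noteq> \<xi>\<^sub>0" for \<xi>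
  proof -
    define D where "D = (norm (z \<xi> - x))\<^sup>2"
    have "z \<xi> - x = (\<xi> - \<xi>\<^sub>0) *\<^sub>R e + (q \<xi> - q \<xi>\<^sub>0) *\<^sub>R w"
      unfolding zx[symmetric] by (simp add: z_def algebra_simps)
    then have D1: "D = (\<xi> - \<xi>\<^sub>0)\<^sup>2 + (q \<xi> - q \<xi>\<^sub>0)\<^sup>2"
      unfolding D_def power2_norm_eq_inner using ew
      by (simp add: inner_add_left inner_add_right norm_eq_1 inner_commute power2_eq_square)
    have D0: "D > 0"
      using \<xi>(2) unfolding D1 by (simp add: add_pos_nonneg)
    have "(z \<xi> - x) \<bullet> v = k * ((\<xi> - \<xi>\<^sub>0) * \<xi>\<^sub>0 + (q \<xi> - q \<xi>\<^sub>0) * q \<xi>\<^sub>0)"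
      unfolding zv using AB unfolding k_def[symmetric] by (metis distrib_left mult.assoc mult.commute)
    also have "(\<xi> - \<xi>\<^sub>0) * \<xi>\<^sub>0 + (q \<xi> - q \<xi>\<^sub>0) * q \<xi>\<^sub>0 = - D / 2"
      unfolding D1 using q2[OF \<xi>0] q2[OF near(1)[OF \<xi>(1)]]
      by (simp add: power2_eq_square algebra_simps)
    finally have zvk: "(z \<xi> - x) \<bullet> v = - (k * D / 2)"
      by simp
    define \<mu> where "\<mu> = k * D / 2"
    have s: "\<mu> \<ge> 0" "D \<le> \<mu>\<^sup>2 + 2 * r * \<mu>"
      using sup[OF near(2,3)[OF \<xi>(1)]] by (simp_all add: zvk \<mu>_def D_def[symmetric])
    have \<mu>1: "\<mu> \<le> D / (2 * \<rho>)"
      using mult_right_mono[OF k, of "D / 2"] D0 by (simp add: \<mu>_def)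
    have "D \<le> (D / (2 * \<rho>))\<^sup>2 + 2 * r * (D / (2 * \<rho>))"
      using s \<mu>1 r by (smt (verit, best) mult_left_mono power_mono)
    also have "\<dots> = D * (D / (4 * \<rho>\<^sup>2) + r / \<rho>)"
      using r by (simp add: power2_eq_square field_simps)
    finally have "1 \<le> D / (4 * \<rho>\<^sup>2) + r / \<rho>"
      using D0 by simp
    then show ?thesis by (simp add: D_def)
  qed
  have "((\<lambda>\<xi>. (norm (z \<xi> - x))\<^sup>2 / (4 * \<rho>\<^sup>2)) \<longlongrightarrow> (norm (x - x))\<^sup>2 / (4 * \<rho>\<^sup>2)) (at \<xi>\<^sub>0)"
    using cont_z zx unfolding isCont_def by (intro tendsto_intros) (use r in auto)
  moreover have "eventually (\<lambda>\<xi>. 1 - r / \<rho> \<le> (norm (z \<xi> - x))\<^sup>2 / (4 * \<rho>\<^sup>2)) (at \<xi>\<^sub>0)"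
    unfolding eventually_at using key \<theta> by (auto simp: dist_real_def intro!: exI[of _ \<theta>])
  ultimately have "1 - r / \<rho> \<le> (norm (x - x))\<^sup>2 / (4 * \<rho>\<^sup>2)"
    by (rule tendsto_lowerbound) simp
  then show False
    using r by (simp add: field_simps)
qed

text \<open>
  The height over its chord, at signed distance \<open>\<xi>\<close> from the midpoint of the chord, of a circular arc
  with curvature \<open>\<kappa>\<close> and chord length \<open>2 * l\<close>. In terms of the radius \<open>\<rho> = 1 / \<kappa>\<close> it is
  \<open>sqrt (\<rho>\<^sup>2 - \<xi>\<^sup>2) - sqrt (\<rho>\<^sup>2 - l\<^sup>2)\<close>; the rationalised form is continuous up to \<open>\<kappa> = 0\<close>, where
  the arc becomes the chord.
\<close>

definition arc_height :: "real \<Rightarrow> real \<Rightarrow> real \<Rightarrow> real" where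
  "arc_height l \<kappa> \<xi> = \<kappa> * (l\<^sup>2 - \<xi>\<^sup>2) / (sqrt (1 - \<kappa>\<^sup>2 * \<xi>\<^sup>2) + sqrt (1 - \<kappa>\<^sup>2 * l\<^sup>2))"

lemma arc_height_circle:
  assumes "\<rho> > 0" "l < \<rho>" "\<bar>\<xi>\<bar> \<le> l"
  shows "arc_height l (1 / \<rho>) \<xi> = sqrt (\<rho>\<^sup>2 - \<xi>\<^sup>2) - sqrt (\<rho>\<^sup>2 - l\<^sup>2)"
proof -
  have l: "l\<^sup>2 < \<rho>\<^sup>2" and \<xi>: "\<xi>\<^sup>2 \<le> l\<^sup>2"
    using assms by (auto simp: abs_le_square_iff[symmetric] intro: power_strict_mono)
  have rescale: "sqrt (1 - (1 / \<rho>)\<^sup>2 * u) = sqrt (\<rho>\<^sup>2 - u) / \<rho>" for u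
  proof -
    have "1 - (1 / \<rho>)\<^sup>2 * u = (\<rho>\<^sup>2 - u) / \<rho>\<^sup>2"
      using assms by (simp add: field_simps)
    then show ?thesis
      using assms by (simp add: real_sqrt_divide)
  qed
  define P Q where "P = sqrt (\<rho>\<^sup>2 - \<xi>\<^sup>2)" and "Q = sqrt (\<rho>\<^sup>2 - l\<^sup>2)"
  have PQ: "P > 0" "Q > 0" "P\<^sup>2 - Q\<^sup>2 = l\<^sup>2 - \<xi>\<^sup>2"
    using l \<xi> by (auto simp: P_def Q_def)
  have "arc_height l (1 / \<rho>) \<xi> = (l\<^sup>2 - \<xi>\<^sup>2) / (P + Q)"
    unfolding arc_height_def rescale P_def[symmetric] Q_def[symmetric]
    using assms(1) by (simp add: add_divide_distrib[symmetric])
  also have "\<dots> = P - Q"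
    unfolding PQ(3)[symmetric] using PQ(1,2) by (simp add: square_diff_square_factored power2_eq_square)
  finally show ?thesis by (simp add: P_def Q_def)
qed

lemma continuous_on_arc_height:
  assumes "0 < l" "l < R"
  shows "continuous_on ({0..1 / R} \<times> {- l..l}) (\<lambda>p. arc_height l (fst p) (snd p))"
proof -
  have pos: "sqrt (1 - \<kappa>\<^sup>2 * \<xi>\<^sup>2) + sqrt (1 - \<kappa>\<^sup>2 * l\<^sup>2) \<noteq> 0"
    if "\<kappa> \<in> {0..1 / R}" "\<xi> \<in> {- l..l}" for \<kappa> \<xi>
  proof -
    have "\<kappa> * l \<le> 1 / R * l"
      using that assms by (intro mult_right_mono) auto
    also have "\<dots> < 1"
      using assms by simp
    finally have "(\<kappa> * l)\<^sup>2 < 1\<^sup>2"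
      using that assms by (intro power_strict_mono) auto
    moreover have "\<xi>\<^sup>2 \<le> l\<^sup>2"
      using that assms by (simp add: abs_le_square_iff[symmetric] abs_le_iff)
    then have "\<kappa>\<^sup>2 * \<xi>\<^sup>2 \<le> \<kappa>\<^sup>2 * l\<^sup>2"
      by (simp add: mult_left_mono)
    ultimately have "1 - \<kappa>\<^sup>2 * l\<^sup>2 > 0" "1 - \<kappa>\<^sup>2 * \<xi>\<^sup>2 > 0"
      by (auto simp: power_mult_distrib)
    then have "sqrt (1 - \<kappa>\<^sup>2 * \<xi>\<^sup>2) > 0" "sqrt (1 - \<kappa>\<^sup>2 * l\<^sup>2) > 0"
      by auto
    then show ?thesis by linarith
  qed
  show ?thesis
    unfolding arc_height_def
    by (intro continuous_intros) (use pos in auto)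
qed

text \<open>
  Among the parameters \<open>(\<kappa>, \<xi>)\<close> of points outside \<open>\<Omega>\<close> there is one with minimal curvature \<open>\<kappa>\<close>, by
  compactness. By minimality, the whole arc with curvature \<open>\<kappa>\<close> is a limit of arcs inside \<open>\<Omega>\<close>, so it
  lies in \<open>closure \<Omega>\<close> and touches the boundary. Its radius is at least \<open>R > r\<close>, which contradicts the
  quadratic support at the point of contact. The bound \<open>l < R\<close> keeps the arcs shorter than a half
  circle, so that they are graphs with finite slope over their chord.
\<close>

lemma arc_subset:
  fixes \<Omega> :: "(real ^ 'n) set"
  assumes r: "r > 0" "r < R" and op: "open \<Omega>" and conv: "convex \<Omega>"
    and qs: "\<And>x. x \<in> frontier \<Omega> \<Longrightarrow> quadratically_supported_locally r \<Omega> x"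
    and l: "0 < l" "l < R" and ew: "norm e = 1" "norm w = 1" "e \<bullet> w = 0"
    and ends: "m - l *\<^sub>R e \<in> \<Omega>" "m + l *\<^sub>R e \<in> \<Omega>"
    and \<xi>: "\<bar>\<xi>\<bar> \<le> l"
  shows "m + \<xi> *\<^sub>R e + (sqrt (R\<^sup>2 - \<xi>\<^sup>2) - sqrt (R\<^sup>2 - l\<^sup>2)) *\<^sub>R w \<in> \<Omega>"
proof -
  define G where "G p = m + snd p *\<^sub>R e + arc_height l (fst p) (snd p) *\<^sub>R w" for p :: "real \<times> real"
  define K where "K = {0..1 / R} \<times> {- l..l}"
  have contG: "continuous_on K G"
    unfolding G_def K_def using l by (intro continuous_intros continuous_on_arc_height) auto
  define Bad where "Bad = {p \<in> K. G p \<in> - \<Omega>}"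
  have "Bad = {}"
  proof (rule ccontr)
    assume "Bad \<noteq> {}"
    have "compact Bad"
    proof -
      have "compact K"
        unfolding K_def by (intro compact_Times) auto
      moreover have "closed Bad"
        unfolding Bad_def
        using continuous_closed_preimage[OF contG _ closed_Compl[OF op]] \<open>compact K\<close>
        by (simp add: compact_imp_closed vimage_def Int_def)
      moreover have "Bad = K \<inter> Bad"
        by (auto simp: Bad_def)
      ultimately show ?thesis
        using compact_Int_closed by metis
    qed
    then obtain p where p: "p \<in> Bad" and min: "\<And>p'. p' \<in> Bad \<Longrightarrow> fst p \<le> fst p'"
      using continuous_attains_inf[OF _ \<open>Bad \<noteq> {}\<close> continuous_on_fst[OF continuous_on_id]] by blast
    obtain \<kappa> \<xi>\<^sub>0 where p_eq: "p = (\<kappa>, \<xi>\<^sub>0)"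
      by (cases p)
    have \<kappa>: "0 \<le> \<kappa>" "\<kappa> \<le> 1 / R" and \<xi>0: "\<bar>\<xi>\<^sub>0\<bar> \<le> l" and out: "G (\<kappa>, \<xi>\<^sub>0) \<notin> \<Omega>"
      using p by (auto simp: p_eq Bad_def K_def)
    have seg: "G (0, \<xi>) \<in> \<Omega>" if "\<bar>\<xi>\<bar> \<le> l" for \<xi>
    proof -
      define t where "t = (\<xi> + l) / (2 * l)"
      have t: "0 \<le> t" "t \<le> 1"
        using that l by (auto simp: t_def field_simps)
      have "2 * t * l = \<xi> + l"
        using l by (simp add: t_def)
      moreover have "(1 - t) *\<^sub>R (m - l *\<^sub>R e) + t *\<^sub>R (m + l *\<^sub>R e) = m + (2 * t * l - l) *\<^sub>R e"
        unfolding scaleR_diff_left scaleR_diff_right scaleR_add_right mult_2 distrib_right scaleR_add_left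
        by simp
      ultimately have "G (0, \<xi>) = (1 - t) *\<^sub>R (m - l *\<^sub>R e) + t *\<^sub>R (m + l *\<^sub>R e)"
        by (simp add: G_def arc_height_def)
      then show ?thesis
        using conv ends t by (simp add: convex_alt)
    qed
    have \<kappa>0: "\<kappa> > 0"
      using seg[OF \<xi>0] out \<kappa> by (cases "\<kappa> = 0") auto
    have "G (\<kappa>, l) = m + l *\<^sub>R e" "G (\<kappa>, - l) = m - l *\<^sub>R e"
      by (simp_all add: G_def arc_height_def)
    then have \<xi>0': "\<bar>\<xi>\<^sub>0\<bar> < l"
      using ends out \<xi>0 by (cases "\<xi>\<^sub>0 = l"; cases "\<xi>\<^sub>0 = - l") auto
    have cl: "G (\<kappa>, \<xi>) \<in> closure \<Omega>" if "\<bar>\<xi>\<bar> \<le> l" for \<xi>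
    proof -
      have "G (u * \<kappa>, \<xi>) \<in> \<Omega>" if u: "0 \<le> u" "u < 1" for u
      proof (rule ccontr)
        assume *: "G (u * \<kappa>, \<xi>) \<notin> \<Omega>"
        have "u * \<kappa> < \<kappa>"
          using u \<kappa>0 by simp
        moreover have "(u * \<kappa>, \<xi>) \<in> Bad"
          using * \<open>u * \<kappa> < \<kappa>\<close> u \<kappa> \<open>\<bar>\<xi>\<bar> \<le> l\<close> by (auto simp: Bad_def K_def)
        ultimately show False
          using min[of "(u * \<kappa>, \<xi>)"] by (simp add: p_eq)
      qed
      then have im: "(\<lambda>u. G (u * \<kappa>, \<xi>)) ` {0..<1} \<subseteq> \<Omega>"
        by auto
      have "continuous_on {0..1} (\<lambda>u. G (u * \<kappa>, \<xi>))"
      proof (rule continuous_on_compose2[OF contG])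
        show "(\<lambda>u. (u * \<kappa>, \<xi>)) ` {0..1} \<subseteq> K"
          using \<kappa> \<open>\<bar>\<xi>\<bar> \<le> l\<close> by (auto simp: K_def intro: order_trans[OF mult_left_le_one_le])
      qed (intro continuous_intros)
      then have "(\<lambda>u. G (u * \<kappa>, \<xi>)) ` closure {0..<1} \<subseteq> closure \<Omega>"
        using im closure_subset[of \<Omega>] by (intro image_closure_subset) auto
      moreover have "(1::real) \<in> closure {0..<1}"
        by simp
      ultimately have "G (1 * \<kappa>, \<xi>) \<in> closure \<Omega>"
        by blast
      then show ?thesis by simp
    qed
    define \<rho> where "\<rho> = 1 / \<kappa>"
    have \<rho>: "R \<le> \<rho>" "\<kappa> = 1 / \<rho>"
      using \<kappa> \<kappa>0 r by (auto simp: \<rho>_def field_simps)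
    define c where "c = m - sqrt (\<rho>\<^sup>2 - l\<^sup>2) *\<^sub>R w"
    have circ: "G (\<kappa>, \<xi>) = c + \<xi> *\<^sub>R e + sqrt (\<rho>\<^sup>2 - \<xi>\<^sup>2) *\<^sub>R w" if "\<bar>\<xi>\<bar> \<le> l" for \<xi>
      using arc_height_circle[of \<rho> l \<xi>] that l \<rho>
      by (simp add: G_def c_def scaleR_diff_left)
    have "G (\<kappa>, \<xi>\<^sub>0) \<in> frontier \<Omega>"
      using cl[OF \<xi>0] out op by (simp add: frontier_def interior_open)
    then obtain v where "quadratically_supports_locally v r \<Omega> (G (\<kappa>, \<xi>\<^sub>0))"
      using qs unfolding quadratically_supported_locally_def by blast
    then show False
    proof (rule no_larger_circle_through_support_point[OF _ r(1) _ ew _ circ[OF \<xi>0]])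
      show "r < \<rho>" "\<bar>\<xi>\<^sub>0\<bar> < \<rho>" "l - \<bar>\<xi>\<^sub>0\<bar> > 0"
        using r \<rho> \<xi>0' l by auto
      fix \<xi> assume "\<bar>\<xi> - \<xi>\<^sub>0\<bar> < l - \<bar>\<xi>\<^sub>0\<bar>"
      then have "\<bar>\<xi>\<bar> \<le> l" by linarith
      then show "c + \<xi> *\<^sub>R e + sqrt (\<rho>\<^sup>2 - \<xi>\<^sup>2) *\<^sub>R w \<in> closure \<Omega>"
        using cl circ by metis
    qed
  qed
  moreover have "(1 / R, \<xi>) \<in> K"
    using \<xi> r by (auto simp: K_def)
  ultimately have "G (1 / R, \<xi>) \<in> \<Omega>"
    by (auto simp: Bad_def)
  then show ?thesis
    using arc_height_circle[of R l \<xi>] l \<xi> r by (simp add: G_def)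
qed

section \<open>From local support to tangent balls\<close>

text \<open>
  Suppose that \<open>y\<close> lies outside the ball. Take the circle of radius \<open>R\<close> through \<open>x\<close> and \<open>y\<close> in the
  plane spanned by \<open>y - x\<close> and \<open>v\<close>, with the minor arc bent towards \<open>v\<close>, and let
  \<open>c = m - Q *\<^sub>R w\<close> be its centre. The point \<open>p = c + R *\<^sub>R v\<close> of the circle lies on the minor arc:
  this is the inequality \<open>- (R * \<alpha>) < l\<close>, which says that \<open>y\<close> is outside the ball. Hence \<open>p\<close> belongs
  to \<open>closure \<Omega>\<close>. But \<open>v \<bullet> (p - x) = R + v \<bullet> (c - x) \<ge> 0\<close> since \<open>norm (c - x) = R\<close>, with equality
  only for \<open>c = x - R *\<^sub>R v\<close>, in which case \<open>y\<close> would be in the ball. So \<open>p\<close> is strictly above the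
  supporting hyperplane, a contradiction.
\<close>

lemma supported_imp_near_points_in_larger_ball:
  fixes \<Omega> :: "(real ^ 'n) set"
  assumes r: "r > 0" "r < R" and op: "open \<Omega>" and conv: "convex \<Omega>"
    and qs: "\<And>x. x \<in> frontier \<Omega> \<Longrightarrow> quadratically_supported_locally r \<Omega> x"
    and x: "x \<in> frontier \<Omega>" and v: "unit_normal v \<Omega> x"
    and y: "y \<in> \<Omega>" "dist y x < 2 * R"
  shows "y \<in> cball (x - R *\<^sub>R v) R"
proof (rule ccontr)
  assume out: "y \<notin> cball (x - R *\<^sub>R v) R"
  have nv: "norm v = 1"
    using v by (simp add: unit_normal_def)
  have xcl: "x \<in> closure \<Omega>"
    using x by (simp add: frontier_def)
  have below: "v \<bullet> (z - x) \<le> 0" if "z \<in> closure \<Omega>" for z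
  proof -
    have "closed {z. v \<bullet> (z - x) \<le> 0}"
      by (intro closed_Collect_le continuous_intros)
    moreover have "\<Omega> \<subseteq> {z. v \<bullet> (z - x) \<le> 0}"
      using v by (auto simp: unit_normal_def)
    ultimately show ?thesis
      using closure_minimal that by blast
  qed
  define l where "l = norm (y - x) / 2"
  have "y \<noteq> x"
    using y(1) frontier_notin_open[OF op x] by blast
  then have l: "0 < l" "l < R"
    using y(2) by (auto simp: l_def dist_norm)
  define e where "e = (1 / (2 * l)) *\<^sub>R (y - x)"
  have ne: "norm e = 1"
    using l by (simp add: e_def l_def)
  then have ee: "e \<bullet> e = 1"
    by (simp add: norm_eq_1)
  have yx: "y = x + (2 * l) *\<^sub>R e"
    using l by (simp add: e_def)
  define \<alpha> where "\<alpha> = v \<bullet> e"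
  have \<alpha>0: "\<alpha> \<le> 0"
    using below[of y] y(1) closure_subset[of \<Omega>] l by (auto simp: yx \<alpha>_def mult_le_0_iff)
  have "\<not> (norm (y - x))\<^sup>2 \<le> 2 * R * (v \<bullet> (x - y))"
    using out mem_cball_tangent_iff[OF nv, of R y x] r by simp
  moreover have "norm (y - x) = 2 * l" "v \<bullet> (x - y) = - (2 * l * \<alpha>)"
    using l ne by (simp_all add: yx \<alpha>_def)
  ultimately have "\<not> (2 * l)\<^sup>2 \<le> 2 * R * (- (2 * l * \<alpha>))"
    by (simp only: not_False_eq_True)
  then have "l * (- (R * \<alpha>)) < l * l"
    by (simp add: power2_eq_square algebra_simps)
  then have lR: "- (R * \<alpha>) < l"
    using l by (simp only: mult_less_cancel_left_pos)
  then have "R * (- \<alpha>) < R * 1"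
    using l by simp
  then have "- \<alpha> < 1"
    using l by (simp only: mult_less_cancel_left_pos)
  then have \<alpha>1: "\<alpha>\<^sup>2 < 1"
    using \<alpha>0 by (simp add: abs_square_less_1)
  define \<sigma> where "\<sigma> = sqrt (1 - \<alpha>\<^sup>2)"
  have \<sigma>: "\<sigma> > 0" "\<sigma>\<^sup>2 = 1 - \<alpha>\<^sup>2"
    using \<alpha>1 by (auto simp: \<sigma>_def)
  define w where "w = (1 / \<sigma>) *\<^sub>R (v - \<alpha> *\<^sub>R e)"
  have v_eq: "v = \<alpha> *\<^sub>R e + \<sigma> *\<^sub>R w"
    using \<sigma> by (simp add: w_def)
  have ew: "e \<bullet> w = 0"
    using ee by (simp add: w_def inner_diff_right \<alpha>_def inner_commute)
  have "(norm (v - \<alpha> *\<^sub>R e))\<^sup>2 = \<sigma>\<^sup>2"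
    unfolding \<alpha>_def using norm_diff_sq_orthogonal[OF ne, of v] nv \<sigma>(2) by (simp add: \<alpha>_def)
  then have "norm (v - \<alpha> *\<^sub>R e) = \<sigma>"
    using \<sigma>(1) by (simp add: power2_eq_iff_nonneg)
  then have nw: "norm w = 1"
    using \<sigma> by (simp add: w_def)
  have vw: "v \<bullet> w = \<sigma>"
    using nw ew by (subst v_eq) (simp add: inner_add_left norm_eq_1)
  define m where "m = x + l *\<^sub>R e"
  define Q where "Q = sqrt (R\<^sup>2 - l\<^sup>2)"
  have "l\<^sup>2 < R\<^sup>2"
    using l by (simp add: power_strict_mono)
  then have Q: "Q > 0" "Q\<^sup>2 = R\<^sup>2 - l\<^sup>2"
    by (auto simp: Q_def)
  have top: "sqrt (R\<^sup>2 - (R * \<alpha>)\<^sup>2) = R * \<sigma>"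
  proof -
    have "R\<^sup>2 - (R * \<alpha>)\<^sup>2 = (R * \<sigma>)\<^sup>2"
      by (simp add: power_mult_distrib \<sigma>(2) algebra_simps)
    then show ?thesis
      using \<sigma>(1) r by simp
  qed
  define p where "p = m + (R * \<alpha>) *\<^sub>R e + (R * \<sigma> - Q) *\<^sub>R w"
  \<comment> \<open>The end point \<open>x\<close> of the arc is not in \<open>\<Omega>\<close>; translating the whole arc by \<open>a - x\<close> with
    \<open>a \<in> \<Omega>\<close> near \<open>x\<close> brings both end points into \<open>\<Omega>\<close> without changing the shape.\<close>
  have "p \<in> closure \<Omega>"
    unfolding closure_approachable
  proof (intro allI impI)
    fix \<epsilon> :: real assume \<epsilon>: "\<epsilon> > 0"
    obtain \<delta> where \<delta>: "\<delta> > 0" "ball y \<delta> \<subseteq> \<Omega>"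
      using op y(1) open_contains_ball by blast
    obtain a where a: "a \<in> \<Omega>" "dist a x < min \<epsilon> \<delta>"
      using xcl \<epsilon> \<delta>(1) unfolding closure_approachable by (metis min_less_iff_conj)
    have "y + (a - x) \<in> \<Omega>"
      using \<delta>(2) a(2) by (auto simp: subset_iff dist_norm norm_minus_commute)
    then have "(m + (a - x)) + l *\<^sub>R e \<in> \<Omega>"
      unfolding m_def yx mult_2 scaleR_add_left by (simp add: algebra_simps)
    moreover have "(m + (a - x)) - l *\<^sub>R e \<in> \<Omega>"
      using a(1) by (simp add: m_def)
    moreover have "\<bar>R * \<alpha>\<bar> \<le> l"
      using lR \<alpha>0 r by (simp add: abs_mult)
    ultimately have "(m + (a - x)) + (R * \<alpha>) *\<^sub>R e + (sqrt (R\<^sup>2 - (R * \<alpha>)\<^sup>2) - sqrt (R\<^sup>2 - l\<^sup>2)) *\<^sub>R w \<in> \<Omega>"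
      by (intro arc_subset[OF r op conv qs l ne nw ew]) auto
    then have "p + (a - x) \<in> \<Omega>"
      unfolding top p_def Q_def by (simp add: algebra_simps)
    moreover have "dist (p + (a - x)) p < \<epsilon>"
      using a(2) by (simp add: dist_norm)
    ultimately show "\<exists>z\<in>\<Omega>. dist z p < \<epsilon>"
      by blast
  qed
  then have "v \<bullet> (p - x) \<le> 0"
    by (rule below)
  moreover have "v \<bullet> (p - x) = R * (\<alpha>\<^sup>2 + \<sigma>\<^sup>2) + (l * \<alpha> - Q * \<sigma>)"
    using vw by (simp add: p_def m_def inner_add_right inner_diff_right \<alpha>_def[symmetric]
        power2_eq_square algebra_simps)
  ultimately have "R \<le> Q * \<sigma> - l * \<alpha>"
    by (simp add: \<sigma>(2))
  then have "R\<^sup>2 \<le> (Q * \<sigma> - l * \<alpha>)\<^sup>2"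
    using r by (intro power_mono) auto
  \<comment> \<open>Lagrange's identity measures how far \<open>v\<close> is from being parallel to \<open>c - x\<close>.\<close>
  also have "\<dots> = (Q\<^sup>2 + l\<^sup>2) * (\<sigma>\<^sup>2 + \<alpha>\<^sup>2) - (l * \<sigma> + Q * \<alpha>)\<^sup>2"
    by (simp add: power2_eq_square algebra_simps)
  finally have "(l * \<sigma> + Q * \<alpha>)\<^sup>2 \<le> 0"
    by (simp add: \<sigma>(2) Q(2))
  then have "l * \<sigma> = Q * (- \<alpha>)"
    by simp
  then have "(l * \<sigma>)\<^sup>2 = (Q * (- \<alpha>))\<^sup>2"
    by simp
  then have "l\<^sup>2 = (R * (- \<alpha>))\<^sup>2"
    by (simp add: power_mult_distrib \<sigma>(2) Q(2) algebra_simps)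
  moreover have "(R * (- \<alpha>))\<^sup>2 < l\<^sup>2"
    using lR \<alpha>0 r by (intro power_strict_mono) (auto simp: mult_nonneg_nonpos)
  ultimately show False by simp
qed

text \<open>
  Let \<open>y\<close> be outside the ball and let \<open>u\<close> be the direction from \<open>x\<close> to \<open>y\<close>. The points \<open>x + d *\<^sub>R u\<close> with
  \<open>d > - (2 * R * (v \<bullet> u))\<close> are outside the ball as well. If \<open>u \<noteq> - v\<close>, this bound is less than
  \<open>2 * R\<close>, and some such point between \<open>x\<close> and \<open>y\<close> contradicts the previous lemma. The case
  \<open>u = - v\<close> is avoided by moving \<open>y\<close> in a direction orthogonal to \<open>v\<close>.
\<close>

lemma supported_imp_subset_larger_ball:
  fixes \<Omega> :: "(real ^ 'n) set"
  assumes dim: "CARD('n) \<ge> 2" and r: "r > 0" "r < R" and op: "open \<Omega>" and conv: "convex \<Omega>"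
    and qs: "\<And>x. x \<in> frontier \<Omega> \<Longrightarrow> quadratically_supported_locally r \<Omega> x"
    and x: "x \<in> frontier \<Omega>" and v: "unit_normal v \<Omega> x"
  shows "\<Omega> \<subseteq> cball (x - R *\<^sub>R v) R"
proof (rule ccontr)
  assume "\<not> \<Omega> \<subseteq> cball (x - R *\<^sub>R v) R"
  then obtain y\<^sub>0 where y0: "y\<^sub>0 \<in> \<Omega> - cball (x - R *\<^sub>R v) R"
    by blast
  have nv: "norm v = 1"
    using v by (simp add: unit_normal_def)
  note near = supported_imp_near_points_in_larger_ball[OF r op conv qs x v]
  obtain y where y: "y \<in> \<Omega> - cball (x - R *\<^sub>R v) R" "y - x \<noteq> - (norm (y - x) *\<^sub>R v)"
  proof (cases "y\<^sub>0 - x = - (norm (y\<^sub>0 - x) *\<^sub>R v)")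
    case True
    have "2 \<le> DIM(real ^ 'n)"
      using dim by simp
    then obtain k where k: "k \<noteq> 0" "orthogonal v k"
      using orthogonal_to_vector_exists by blast
    have "open (\<Omega> - cball (x - R *\<^sub>R v) R)"
      using op by (intro open_Diff) auto
    then obtain \<delta> where \<delta>: "\<delta> > 0" "cball y\<^sub>0 \<delta> \<subseteq> \<Omega> - cball (x - R *\<^sub>R v) R"
      using y0 open_contains_cball by metis
    define y where "y = y\<^sub>0 + (\<delta> / norm k) *\<^sub>R k"
    have "y \<in> cball y\<^sub>0 \<delta>"
      using k \<delta> by (simp add: y_def dist_norm)
    then have "y \<in> \<Omega> - cball (x - R *\<^sub>R v) R"
      using \<delta> by blast
    moreover have "y - x \<noteq> - (norm (y - x) *\<^sub>R v)"
    proof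
      assume *: "y - x = - (norm (y - x) *\<^sub>R v)"
      have "(y - x) \<bullet> k = 0"
        using k(2) by (subst *) (simp add: orthogonal_def)
      moreover have "(y\<^sub>0 - x) \<bullet> k = 0"
        using k(2) by (subst True) (simp add: orthogonal_def)
      moreover have "(y - x) \<bullet> k = (y\<^sub>0 - x) \<bullet> k + (\<delta> / norm k) * (k \<bullet> k)"
        by (simp add: y_def inner_diff_left inner_add_left)
      ultimately show False
        using k \<delta> by simp
    qed
    ultimately show thesis
      using that by blast
  qed (use y0 that in blast)
  define N where "N = norm (y - x)"
  have Nbig: "N \<ge> 2 * R"
    using near[of y] y(1) by (force simp: N_def dist_norm)
  then have N: "N > 0"
    using r by linarith
  define u where "u = (1 / N) *\<^sub>R (y - x)"
  have nu: "norm u = 1"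
    using N by (simp add: u_def N_def)
  have yx: "y - x = N *\<^sub>R u"
    using N by (simp add: u_def)
  then have "u + v \<noteq> 0"
    using y(2) unfolding N_def[symmetric] by (metis add_eq_0_iff2 scaleR_minus_right)
  then have "0 < (norm (u + v))\<^sup>2"
    by simp
  also have "\<dots> = 2 + 2 * (v \<bullet> u)"
    unfolding power2_norm_eq_inner using nu nv
    by (simp add: inner_add_left inner_add_right norm_eq_1 inner_commute)
  finally have uv: "- (2 * R * (v \<bullet> u)) < 2 * R"
    using r mult_strict_left_mono[of "- (v \<bullet> u)" 1 R] by simp
  obtain d where d: "0 < d" "- (2 * R * (v \<bullet> u)) < d" "d < 2 * R"
    using dense[of "max 0 (- (2 * R * (v \<bullet> u)))" "2 * R"] uv r by auto
  have "y \<in> interior \<Omega>" "x \<in> closure \<Omega>"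
    using y x op by (simp_all add: interior_open frontier_def)
  then have "x - (d / N) *\<^sub>R (x - y) \<in> interior \<Omega>"
    using d Nbig N by (intro mem_interior_closure_convex_shrink[OF conv]) auto
  moreover have "x - (d / N) *\<^sub>R (x - y) = x + d *\<^sub>R u"
    using N by (simp add: u_def algebra_simps)
  ultimately have "x + d *\<^sub>R u \<in> \<Omega>"
    using op by (simp add: interior_open)
  then have "x + d *\<^sub>R u \<in> cball (x - R *\<^sub>R v) R"
    using near[of "x + d *\<^sub>R u"] d nu by (simp add: dist_norm)
  then have "d * d \<le> d * (- (2 * R * (v \<bullet> u)))"
    using mem_cball_tangent_iff[OF nv, of R "x + d *\<^sub>R u" x] r nu
    by (simp add: power2_eq_square algebra_simps)
  then show False
    using d(1,2) by (simp only: mult_le_cancel_left_pos)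
qed

lemma supported_imp_tangent_ball:
  fixes \<Omega> :: "(real ^ 'n) set"
  assumes dim: "CARD('n) \<ge> 2" and r: "r > 0" and op: "open \<Omega>" and conv: "convex \<Omega>"
    and qs: "\<And>x. x \<in> frontier \<Omega> \<Longrightarrow> quadratically_supported_locally r \<Omega> x"
    and x: "x \<in> frontier \<Omega>" and v: "unit_normal v \<Omega> x"
  shows "\<Omega> \<subseteq> cball (x - r *\<^sub>R v) r"
proof
  fix y assume y: "y \<in> \<Omega>"
  have nv: "norm v = 1"
    using v by (simp add: unit_normal_def)
  have "(norm (y - x))\<^sup>2 \<le> 2 * r * (v \<bullet> (x - y)) + t * (2 * (v \<bullet> (x - y)))" if "0 < t" for t
  proof -
    have "y \<in> cball (x - (r + t) *\<^sub>R v) (r + t)"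
      using supported_imp_subset_larger_ball[OF dim r _ op conv qs x v, of "r + t"] y that by auto
    then have "(norm (y - x))\<^sup>2 \<le> 2 * (r + t) * (v \<bullet> (x - y))"
      using mem_cball_tangent_iff[OF nv, of "r + t" y x] r that by simp
    then show ?thesis
      by (simp add: distrib_left distrib_right mult.assoc)
  qed
  then have "(norm (y - x))\<^sup>2 \<le> 2 * r * (v \<bullet> (x - y))"
    by (rule le_of_le_add_small_multiple)
  then show "y \<in> cball (x - r *\<^sub>R v) r"
    using mem_cball_tangent_iff[OF nv] r by simp
qed

lemma open_convex_unit_normal_exists:
  fixes \<Omega> :: "(real ^ 'n) set"
  assumes "open \<Omega>" "convex \<Omega>" "x \<in> frontier \<Omega>"
  obtains v where "unit_normal v \<Omega> x"
proof -
  have "x \<in> closure \<Omega>" "x \<notin> rel_interior \<Omega>"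
    using assms by (auto simp: frontier_def rel_interior_open interior_open)
  then obtain a where a: "a \<noteq> 0" "\<And>y. y \<in> closure \<Omega> \<Longrightarrow> a \<bullet> x \<le> a \<bullet> y"
    using supporting_hyperplane_relative_frontier[OF assms(2)] by metis
  have "unit_normal (- (1 / norm a) *\<^sub>R a) \<Omega> x"
    unfolding unit_normal_def
    using a closure_subset[of \<Omega>] by (auto simp: inner_diff_right divide_simps)
  then show thesis
    using that by blast
qed

theorem theorem3p13:
  fixes r :: real and \<Omega> :: "(real ^ 'n) set"
  assumes "CARD('n) \<ge> 2" and "r > 0" and "open \<Omega>" and "connected \<Omega>"
  shows "(r_convex r \<Omega> \<longleftrightarrow>
            convex \<Omega> \<and>
            (\<forall>x\<in>frontier \<Omega>. \<forall>v. unit_normal v \<Omega> x \<longrightarrow> quadratically_supports_locally v r \<Omega> x))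
       \<and> (r_convex r \<Omega> \<longleftrightarrow>
            (\<forall>x\<in>frontier \<Omega>. quadratically_supported_locally r \<Omega> x))"
    (is "(?i \<longleftrightarrow> ?ii) \<and> (?i \<longleftrightarrow> ?iii)")
proof -
  have 1: ?ii if ?i
  proof (intro conjI ballI allI impI)
    show "convex \<Omega>"
      using that by (rule r_convex_imp_convex)
    fix x v assume x: "x \<in> frontier \<Omega>" and v: "unit_normal v \<Omega> x"
    show "quadratically_supports_locally v r \<Omega> x"
    proof (rule tangent_ball_imp_quadratically_supports_locally)
      show "norm v = 1"
        using v by (simp add: unit_normal_def)
    qed (rule r_convex_unit_normal_imp_tangent_ball[OF that assms(2,3) x v])
  qed
  have 2: ?iii if ?ii
    unfolding quadratically_supported_locally_def
    using that open_convex_unit_normal_exists[OF assms(3)] by metis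
  have 3: ?i if iii: ?iii
  proof (rule tangent_balls_imp_r_convex[OF assms(2,3)])
    have conv: "convex \<Omega>"
      using quadratically_supported_imp_convex[OF assms(2-4)] iii by blast
    fix x assume x: "x \<in> frontier \<Omega>"
    then obtain v where "quadratically_supports_locally v r \<Omega> x"
      using iii unfolding quadratically_supported_locally_def by blast
    then have v: "unit_normal v \<Omega> x"
      using x by (intro supports_locally_imp_unit_normal[OF _ assms(2) conv])
        (auto simp: frontier_def)
    show "\<exists>v. norm v = 1 \<and> \<Omega> \<subseteq> cball (x - r *\<^sub>R v) r"
      using supported_imp_tangent_ball[OF assms(1-3) conv _ x v] iii v
      by (auto simp: unit_normal_def)
  qed
  from 1 2 3 show ?thesis by blast
qed

end
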